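(* Let $h(x)$ be a polynomial with real coefficients. For every integer $n\ge 1$ and every real $x$, the $h(x)$-Fibonacci polynomial $F_{n,h}$ satisfies $$F_{n,h}(x)=\left(\frac{i}{2}\right)^{n-1}\left(\sqrt{h^{2}(x)+4}\right)^{n-1}\beta_{n-1}\left(\frac{-i\,h(x)}{\sqrt{h^{2}(x)+4}}\right)=\frac{1}{2^{n-1}}\sum_{k=0}^{\lfloor (n-1)/2\rfloor}\binom{n}{2k+1}h^{n-1-2k}(x)\left(h^{2}(x)+4\right)^{k}.$$
   Context: For each integer $n\ge 0$, $\beta_n$ is the polynomial $\beta_n(y)=\sum_{k=0}^{\lfloor n/2\rfloor}(-1)^k\binom{n+1}{2k+1}y^{n-2k}$ (so $\beta_n(y)=\operatorname{Im}((y+i)^{n+1})$ for real $y$); it is evaluated at complex arguments as a polynomial. The $h(x)$-Fibonacci polynomials are given by $F_{n,h}(x)=i^{n-1}U_{n-1}\left(\frac{h(x)}{2i}\right)$ for $n\ge1$, where $U_n$ is the Chebyshev polynomial of the second kind, $U_n(\cos\theta)=\sin((n+1)\theta)/\sin\theta$ (equivalently $F_{0,h}=0$, $F_{1,h}=1$, $F_{n+1,h}=hF_{n,h}+F_{n-1,h}$). Here $h^m(x)$ means $(h(x))^m$. *)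

theory Defs
  imports "HOL-Analysis.Analysis" "HOL-Computational_Algebra.Polynomial"
begin

definition beta_poly :: "nat \<Rightarrow> complex poly" where
  "beta_poly n =
     (\<Sum>k=0..n div 2. monom ((-1) ^ k * of_nat ((n + 1) choose (2 * k + 1))) (n - 2 * k))"

(* The polynomial is considered over the complex numbers because it is evaluated at h(x)/(2i).
   Existence and uniqueness are shown below, so the description is proper. *)
definition chebyshev_U :: "nat \<Rightarrow> complex poly" where
  "chebyshev_U n =
     (THE p. \<forall>\<theta>::real. sin \<theta> \<noteq> 0 \<longrightarrow>
        poly p (of_real (cos \<theta>)) = of_real (sin (real (n + 1) * \<theta>) / sin \<theta>))"

(* F(n,h) as a polynomial in x; the coefficients of h are embedded into the complex numbers.
   The value 0 at n = 0 is the usual convention. *)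
definition h_fibonacci :: "real poly \<Rightarrow> nat \<Rightarrow> complex poly" where
  "h_fibonacci h n =
     (if n = 0 then 0
      else smult (\<i> ^ (n - 1))
             (pcompose (chebyshev_U (n - 1)) (smult (1 / (2 * \<i>)) (map_poly of_real h))))"

lemma beta_poly_eq_Im:
  fixes y :: real
  shows "poly (beta_poly n) (of_real y) = of_real (Im ((of_real y + \<i>) ^ (n + 1)))"
proof -
  define f :: "nat \<Rightarrow> real" where
    "f j = real ((n + 1) choose j) * y ^ (n + 1 - j) * Im (\<i> ^ j)" for j
  have "(of_real y + \<i>) ^ (n + 1) = (\<i> + of_real y) ^ (n + 1)"
    by (simp add: add.commute)
  also have "\<dots> = (\<Sum>j\<le>n+1. of_nat ((n + 1) choose j) * \<i> ^ j * of_real y ^ (n + 1 - j))"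
    by (rule binomial_ring)
  also have "\<dots> = (\<Sum>j\<le>n+1. of_real (real ((n + 1) choose j) * y ^ (n + 1 - j)) * \<i> ^ j)"
    by (rule sum.cong) (simp_all add: mult_ac)
  finally have "Im ((of_real y + \<i>) ^ (n + 1)) = (\<Sum>j\<le>n+1. f j)"
    unfolding f_def by (simp only: Im_sum Im_complex_of_real Re_complex_of_real times_complex.sel) simp
  also have "\<dots> = (\<Sum>j\<in>(\<lambda>k. 2 * k + 1) ` {0..n div 2}. f j)"
  proof (rule sum.mono_neutral_right)
    show "(\<lambda>k. 2 * k + 1) ` {0..n div 2} \<subseteq> {..n+1}" by auto
    show "\<forall>j\<in>{..n+1} - (\<lambda>k. 2 * k + 1) ` {0..n div 2}. f j = 0"
    proof
      fix j assume j: "j \<in> {..n+1} - (\<lambda>k. 2 * k + 1) ` {0..n div 2}"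
      have "even j"
      proof (rule ccontr)
        assume "odd j"
        then obtain k where "j = 2 * k + 1" by (elim oddE)
        with j show False by auto
      qed
      then obtain k where "j = 2 * k" by (elim evenE)
      then have "\<i> ^ j = of_real ((-1) ^ k)" by (simp add: power_mult)
      then show "f j = 0" unfolding f_def by (simp only: Im_complex_of_real mult_zero_right)
    qed
  qed simp
  also have "\<dots> = (\<Sum>k=0..n div 2. f (2 * k + 1))"
    by (subst sum.reindex) (auto simp: inj_on_def)
  also have "\<dots> = (\<Sum>k=0..n div 2. (-1) ^ k * real ((n + 1) choose (2 * k + 1)) * y ^ (n - 2 * k))"
  proof (rule sum.cong[OF refl])
    fix k
    have "\<i> ^ (2 * k + 1) = of_real ((-1) ^ k) * \<i>" by (simp add: power_mult)
    then have "Im (\<i> ^ (2 * k + 1)) = (-1) ^ k"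
      by (simp only: times_complex.sel Im_complex_of_real Re_complex_of_real) simp
    then show "f (2 * k + 1) = (-1) ^ k * real ((n + 1) choose (2 * k + 1)) * y ^ (n - 2 * k)"
      unfolding f_def by simp
  qed
  finally have "complex_of_real (Im ((of_real y + \<i>) ^ (n + 1))) =
     of_real (\<Sum>k=0..n div 2. (-1) ^ k * real ((n + 1) choose (2 * k + 1)) * y ^ (n - 2 * k))"
    by simp
  then show ?thesis
    unfolding beta_poly_def by (simp add: poly_sum poly_monom)
qed

lemma chebyshev_U_exists:
  "\<exists>p :: complex poly. \<forall>\<theta>::real. sin \<theta> \<noteq> 0 \<longrightarrow>
     poly p (of_real (cos \<theta>)) = of_real (sin (real (n + 1) * \<theta>) / sin \<theta>)"
proof (induction n rule: less_induct)
  case (less n)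
  consider "n = 0" | "n = 1" | m where "n = Suc (Suc m)"
    by (metis One_nat_def not0_implies_Suc)
  then show ?case
  proof cases
    case 1
    then show ?thesis by (intro exI[of _ 1]) simp
  next
    case 2
    then show ?thesis
      by (intro exI[of _ "[:0, 2:]"]) (simp add: sin_double)
  next
    case 3
    from less.IH[of "Suc m"] 3 obtain p :: "complex poly" where p:
      "\<And>\<theta>::real. sin \<theta> \<noteq> 0 \<Longrightarrow>
         poly p (of_real (cos \<theta>)) = of_real (sin (real (Suc m + 1) * \<theta>) / sin \<theta>)"
      by auto
    from less.IH[of m] 3 obtain q :: "complex poly" where q:
      "\<And>\<theta>::real. sin \<theta> \<noteq> 0 \<Longrightarrow>
         poly q (of_real (cos \<theta>)) = of_real (sin (real (m + 1) * \<theta>) / sin \<theta>)"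
      by auto
    show ?thesis
    proof (intro exI[of _ "[:0, 2:] * p - q"] allI impI)
      fix \<theta> :: real assume s: "sin \<theta> \<noteq> 0"
      define a where "a = real (Suc m + 1) * \<theta>"
      have e: "real (n + 1) * \<theta> = a + \<theta>" "real (m + 1) * \<theta> = a - \<theta>"
        using 3 by (simp_all add: a_def algebra_simps)
      have "sin (a + \<theta>) / sin \<theta> = 2 * cos \<theta> * (sin a / sin \<theta>) - sin (a - \<theta>) / sin \<theta>"
        using s by (simp add: sin_add sin_diff field_simps)
      then show "poly ([:0, 2:] * p - q) (of_real (cos \<theta>)) =
          of_real (sin (real (n + 1) * \<theta>) / sin \<theta>)"
        using p[OF s] q[OF s] unfolding e a_def[symmetric] by simp
    qed
  qed
qed

lemma chebyshev_U_unique: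
  fixes p q :: "complex poly"
  assumes "\<And>\<theta>::real. sin \<theta> \<noteq> 0 \<Longrightarrow> poly p (of_real (cos \<theta>)) = poly q (of_real (cos \<theta>))"
  shows "p = q"
proof (rule ccontr)
  assume "p \<noteq> q"
  then have fin: "finite {z. poly (p - q) z = 0}"
    by (intro poly_roots_finite) simp
  have "of_real ` {-1<..<1::real} \<subseteq> {z. poly (p - q) z = 0}"
  proof safe
    fix t :: real assume t: "t \<in> {-1<..<1}"
    then have "cos (arccos t) = t" "sin (arccos t) \<noteq> 0"
      using sin_arccos_nonzero[of t] by (auto intro: cos_arccos)
    then show "poly (p - q) (of_real t) = 0"
      using assms[of "arccos t"] by simp
  qed
  then have "finite (complex_of_real ` {-1<..<1::real})"
    using fin finite_subset by blast
  then have "finite {-1<..<1::real}"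
    by (rule finite_imageD) (auto simp: inj_on_def)
  then show False
    using infinite_Ioo[of "-1::real" 1] by simp
qed

lemma chebyshev_U_cos:
  fixes \<theta> :: real
  assumes "sin \<theta> \<noteq> 0"
  shows "poly (chebyshev_U n) (of_real (cos \<theta>)) = of_real (sin (real (n + 1) * \<theta>) / sin \<theta>)"
proof -
  have "\<exists>!p :: complex poly. \<forall>\<theta>::real. sin \<theta> \<noteq> 0 \<longrightarrow>
     poly p (of_real (cos \<theta>)) = of_real (sin (real (n + 1) * \<theta>) / sin \<theta>)"
    using chebyshev_U_exists[of n] by (auto intro!: chebyshev_U_unique)
  from theI'[OF this] show ?thesis
    using assms unfolding chebyshev_U_def by blast
qed

lemma chebyshev_U_rec:
  "chebyshev_U 0 = 1" "chebyshev_U 1 = [:0, 2:]"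
  "chebyshev_U (Suc (Suc m)) = [:0, 2:] * chebyshev_U (Suc m) - chebyshev_U m"
proof -
  show "chebyshev_U 0 = 1"
    by (rule chebyshev_U_unique) (simp add: chebyshev_U_cos)
  show "chebyshev_U 1 = [:0, 2:]"
    by (rule chebyshev_U_unique) (simp add: chebyshev_U_cos sin_double)
  show "chebyshev_U (Suc (Suc m)) = [:0, 2:] * chebyshev_U (Suc m) - chebyshev_U m"
  proof (rule chebyshev_U_unique)
    fix \<theta> :: real assume s: "sin \<theta> \<noteq> 0"
    define a where "a = real (Suc m + 1) * \<theta>"
    have e: "real (Suc (Suc m) + 1) * \<theta> = a + \<theta>" "real (m + 1) * \<theta> = a - \<theta>"
      by (simp_all add: a_def algebra_simps)
    have "sin (a + \<theta>) / sin \<theta> = 2 * cos \<theta> * (sin a / sin \<theta>) - sin (a - \<theta>) / sin \<theta>"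
      using s by (simp add: sin_add sin_diff field_simps)
    then show "poly (chebyshev_U (Suc (Suc m))) (of_real (cos \<theta>)) =
        poly ([:0, 2:] * chebyshev_U (Suc m) - chebyshev_U m) (of_real (cos \<theta>))"
      using chebyshev_U_cos[OF s, of "Suc (Suc m)"] chebyshev_U_cos[OF s, of "Suc m"]
        chebyshev_U_cos[OF s, of m]
      unfolding e a_def[symmetric] by simp
  qed
qed

lemma poly_map_poly_of_real:
  "poly (map_poly of_real h) (of_real x) = complex_of_real (poly h x)"
  by (induction h) (simp_all add: map_poly_pCons)

lemma poly_h_fibonacci:
  assumes "n \<ge> 1"
  shows "poly (h_fibonacci h n) (of_real x) =
    \<i> ^ (n - 1) * poly (chebyshev_U (n - 1)) (of_real (poly h x) / (2 * \<i>))"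
  using assms by (simp add: h_fibonacci_def poly_pcompose poly_map_poly_of_real)

lemma h_fibonacci_rec:
  "h_fibonacci h 0 = 0" "h_fibonacci h 1 = 1"
  "n \<ge> 1 \<Longrightarrow> h_fibonacci h (n + 1) =
     map_poly of_real h * h_fibonacci h n + h_fibonacci h (n - 1)"
proof -
  show "h_fibonacci h 0 = 0" "h_fibonacci h 1 = 1"
    using chebyshev_U_rec(1) by (simp_all add: h_fibonacci_def pcompose_1)
  assume "n \<ge> 1"
  then consider "n = 1" | m where "n = Suc (Suc m)"
    by (metis One_nat_def not0_implies_Suc not_one_le_zero)
  then show "h_fibonacci h (n + 1) =
     map_poly of_real h * h_fibonacci h n + h_fibonacci h (n - 1)"
  proof cases
    case 1
    then show ?thesis
      using chebyshev_U_rec(1,2)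
      by (simp add: h_fibonacci_def pcompose_1 pcompose_pCons)
  next
    case 2
    have i: "1 / (2 * \<i>) = - \<i> / 2" by (simp add: field_simps)
    show ?thesis
      unfolding h_fibonacci_def i
      by (simp add: 2 chebyshev_U_rec(3) pcompose_diff pcompose_mult pcompose_smult
          pcompose_pCons smult_diff_right algebra_simps)
  qed
qed

end

(* Binet's formula: F_n = (a^n - b^n) / (a - b) for a, b = (h \<plusminus> sqrt (h^2 + 4)) / 2.  Expanding the
   n-th powers leaves only the odd terms of the binomial series, which gives the sum; the factors
   \<i> in the expression with beta_{n-1} cancel its alternating signs term by term. *)
theory Submission
  imports Defs
begin

text \<open>Even powers of \<open>s\<close> cancel and odd ones double. Pulling \<open>2 * s\<close>
  out of the latter leaves \<open>s\<close> only through \<open>s\<^sup>2\<close>, ready to be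
  replaced by \<open>h^2 + 4\<close>.\<close>

lemma power_add_minus_power_diff:
  fixes a s :: "'a::comm_ring_1"
  assumes "n \<ge> 1"
  shows "(a + s) ^ n - (a - s) ^ n =
    2 * s * (\<Sum>k=0..(n - 1) div 2. of_nat (n choose (2 * k + 1)) * a ^ (n - 1 - 2 * k) * (s\<^sup>2) ^ k)"
proof -
  define f where "f j = of_nat (n choose j) * a ^ (n - j) * (s ^ j - (- s) ^ j)" for j
  have "(a + s) ^ n - (a - s) ^ n = (s + a) ^ n - (- s + a) ^ n"
    by (simp add: add.commute)
  also have "\<dots> = (\<Sum>j\<le>n. f j)"
    unfolding binomial_ring f_def sum_subtractf[symmetric]
    by (rule sum.cong) (simp_all add: algebra_simps)
  also have "\<dots> = (\<Sum>j\<in>(\<lambda>k. 2 * k + 1) ` {0..(n - 1) div 2}. f j)"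
  proof (rule sum.mono_neutral_right)
    \<comment> \<open>Here \<open>n \<ge> 1\<close> matters: for \<open>n = 0\<close> the truncated
      \<open>n - 1\<close> would still admit \<open>k = 0\<close>, whose index 1 exceeds
      \<open>n\<close>.\<close>
    show "(\<lambda>k. 2 * k + 1) ` {0..(n - 1) div 2} \<subseteq> {..n}" using assms by auto
    show "\<forall>j\<in>{..n} - (\<lambda>k. 2 * k + 1) ` {0..(n - 1) div 2}. f j = 0"
    proof
      fix j assume j: "j \<in> {..n} - (\<lambda>k. 2 * k + 1) ` {0..(n - 1) div 2}"
      have "even j"
      proof (rule ccontr)
        assume "odd j"
        then obtain k where "j = 2 * k + 1" by (elim oddE)
        with j show False by auto
      qed
      then show "f j = 0" by (simp add: f_def)
    qed
  qed simp
  also have "\<dots> = (\<Sum>k=0..(n - 1) div 2. f (2 * k + 1))"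
    by (subst sum.reindex) (auto simp: inj_on_def)
  also have "\<dots> = 2 * s *
      (\<Sum>k=0..(n - 1) div 2. of_nat (n choose (2 * k + 1)) * a ^ (n - 1 - 2 * k) * (s\<^sup>2) ^ k)"
    unfolding sum_distrib_left
    by (rule sum.cong) (simp_all add: f_def power_mult[symmetric] algebra_simps)
  finally show ?thesis .
qed

text \<open>Since \<open>s\<close> is the difference of the two bases, this is Binet's formula with
  the denominator cleared. Both sides satisfy the Fibonacci recurrence, so agreement at 0 and 1
  suffices.\<close>

lemma h_fibonacci_binet:
  fixes s :: complex
  assumes s: "s\<^sup>2 = (of_real (poly h x))\<^sup>2 + 4"
  shows "s * poly (h_fibonacci h n) (of_real x) =
    ((of_real (poly h x) + s) / 2) ^ n - ((of_real (poly h x) - s) / 2) ^ n"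
proof (induction n rule: less_induct)
  case (less n)
  define a b where "a = (of_real (poly h x) + s) / 2" and "b = (of_real (poly h x) - s) / 2"
  consider "n = 0" | "n = 1" | m where "n = Suc (Suc m)"
    by (metis One_nat_def not0_implies_Suc)
  then show ?case
  proof cases
    case 1
    then show ?thesis by (simp add: h_fibonacci_rec)
  next
    case 2
    then show ?thesis using h_fibonacci_rec(2)[of h] by (simp add: field_simps)
  next
    case 3
    \<comment> \<open>Both bases are roots of the characteristic equation t^2 = h(x) t + 1; its
      discriminant is \<open>s\<^sup>2\<close>.\<close>
    have a: "a\<^sup>2 = of_real (poly h x) * a + 1" and b: "b\<^sup>2 = of_real (poly h x) * b + 1"
      using s by (simp_all add: a_def b_def power2_eq_square field_simps)
    have "s * poly (h_fibonacci h n) (of_real x) =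
        of_real (poly h x) * (s * poly (h_fibonacci h (Suc m)) (of_real x)) +
        s * poly (h_fibonacci h m) (of_real x)"
      using h_fibonacci_rec(3)[of "Suc m" h] 3
      by (simp add: poly_map_poly_of_real algebra_simps)
    also have "\<dots> = of_real (poly h x) * (a ^ Suc m - b ^ Suc m) + (a ^ m - b ^ m)"
      using less.IH[of "Suc m"] less.IH[of m] 3 by (simp add: a_def b_def)
    also have "\<dots> = a ^ m * (of_real (poly h x) * a + 1) - b ^ m * (of_real (poly h x) * b + 1)"
      by (simp add: algebra_simps)
    also have "\<dots> = a ^ n - b ^ n"
      by (simp add: a[symmetric] b[symmetric] 3 power2_eq_square)
    finally show ?thesis by (simp add: a_def b_def)
  qed
qed

text \<open>Binet's formula is used with the positive real root \<open>s\<close> of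
  \<open>H\<^sup>2 + 4\<close>, which can be cancelled at the end.\<close>

lemma poly_h_fibonacci_eq_sum:
  assumes "n \<ge> 1"
  shows "poly (h_fibonacci h n) (of_real x) =
    of_real (1 / 2 ^ (n - 1) *
      (\<Sum>k=0..(n - 1) div 2. real (n choose (2 * k + 1)) * (poly h x) ^ (n - 1 - 2 * k) *
         ((poly h x)\<^sup>2 + 4) ^ k))"
proof -
  define H where "H = poly h x"
  define s where "s = sqrt (H\<^sup>2 + 4)"
  define S where "S = (\<Sum>k=0..(n - 1) div 2.
    real (n choose (2 * k + 1)) * H ^ (n - 1 - 2 * k) * (H\<^sup>2 + 4) ^ k)"
  have s2: "s\<^sup>2 = H\<^sup>2 + 4" by (simp add: s_def)
  have "H\<^sup>2 + 4 > 0" by (rule add_nonneg_pos) auto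
  then have s0: "s > 0" by (simp add: s_def)
  obtain m where n: "n = Suc m" using assms by (cases n) auto
  have "(of_real s)\<^sup>2 = (complex_of_real H)\<^sup>2 + 4"
    by (metis of_real_add of_real_numeral of_real_power s2)
  then have "of_real s * poly (h_fibonacci h n) (of_real x) =
      ((of_real H + of_real s) / 2) ^ n - ((of_real H - of_real s) / 2) ^ n"
    unfolding H_def by (rule h_fibonacci_binet)
  also have "\<dots> = complex_of_real (((H + s) ^ n - (H - s) ^ n) / 2 ^ n)"
    by (simp add: power_divide) (simp add: diff_divide_distrib)
  \<comment> \<open>The doubling of the odd terms turns the denominator \<open>2 ^ n\<close> into
    \<open>2 ^ (n - 1)\<close>.\<close>
  also have "((H + s) ^ n - (H - s) ^ n) / 2 ^ n = s * (1 / 2 ^ (n - 1) * S)"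
    using power_add_minus_power_diff[OF assms, of H s] by (simp add: S_def s2 n)
  finally have "poly (h_fibonacci h n) (of_real x) = of_real (1 / 2 ^ (n - 1) * S)"
    using s0 by (simp only: of_real_mult mult_cancel_left of_real_eq_0_iff) auto
  then show ?thesis unfolding S_def H_def .
qed

text \<open>In the k-th term of \<open>beta_poly m\<close>, \<open>2 * k\<close> of the
  \<open>m\<close> factors \<open>\<i> * s\<close> combine with the sign \<open>(-1) ^ k\<close> to
  \<open>(s\<^sup>2) ^ k\<close>, because \<open>(\<i> * s)\<^sup>2 * (-1) = s\<^sup>2\<close>. Each
  remaining factor meets one argument \<open>- \<i> * a / s\<close>, and their product is
  \<open>a\<close>.\<close>

lemma scaled_beta_poly_eq_sum:
  fixes s a :: complex
  assumes "s \<noteq> 0"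
  shows "(\<i> / 2) ^ m * s ^ m * poly (beta_poly m) (- \<i> * a / s) =
    1 / 2 ^ m * (\<Sum>k=0..m div 2. of_nat (Suc m choose (2 * k + 1)) * a ^ (m - 2 * k) * (s\<^sup>2) ^ k)"
proof -
  have *: "(\<i> * s) ^ m * ((-1) ^ k * (- \<i> * a / s) ^ (m - 2 * k)) = a ^ (m - 2 * k) * (s\<^sup>2) ^ k"
    if "k \<le> m div 2" for k
  proof -
    have "2 * k \<le> m" using that by linarith
    \<comment> \<open>Here \<open>l\<close> counts the factors paired with the argument; the
      additive form avoids truncated subtraction in the exponents.\<close>
    then obtain l where m: "m = 2 * k + l" using le_Suc_ex by blast
    have "(\<i> * s) ^ m * ((-1) ^ k * (- \<i> * a / s) ^ (m - 2 * k)) =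
        ((\<i> * s)\<^sup>2 * (-1)) ^ k * ((\<i> * s) * (- \<i> * a / s)) ^ l"
      unfolding m by (simp only: power_add power_mult power_mult_distrib) simp
    also have "\<dots> = (s\<^sup>2) ^ k * a ^ l"
      using assms by (simp add: power_mult_distrib)
    finally show ?thesis by (simp add: m mult.commute)
  qed
  have "(\<i> / 2) ^ m * s ^ m * poly (beta_poly m) (- \<i> * a / s) =
      1 / 2 ^ m * ((\<i> * s) ^ m * poly (beta_poly m) (- \<i> * a / s))"
    by (simp add: power_mult_distrib power_divide)
  also have "(\<i> * s) ^ m * poly (beta_poly m) (- \<i> * a / s) =
      (\<Sum>k=0..m div 2. of_nat (Suc m choose (2 * k + 1)) *
         ((\<i> * s) ^ m * ((-1) ^ k * (- \<i> * a / s) ^ (m - 2 * k))))"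
    unfolding beta_poly_def poly_sum poly_monom sum_distrib_left
    by (rule sum.cong) (simp_all add: mult_ac)
  also have "\<dots> = (\<Sum>k=0..m div 2. of_nat (Suc m choose (2 * k + 1)) * a ^ (m - 2 * k) * (s\<^sup>2) ^ k)"
    using * by (intro sum.cong) (simp_all only: atLeastAtMost_iff mult.assoc)
  finally show ?thesis .
qed

theorem mainTheorem7:
  fixes h :: "real poly" and n :: nat and x :: real
  assumes "n \<ge> 1"
  shows "poly (h_fibonacci h n) (of_real x) =
           (\<i> / 2) ^ (n - 1) * (of_real (sqrt ((poly h x)\<^sup>2 + 4))) ^ (n - 1) *
           poly (beta_poly (n - 1))
             (- \<i> * of_real (poly h x) / of_real (sqrt ((poly h x)\<^sup>2 + 4)))
       \<and> (\<i> / 2) ^ (n - 1) * (of_real (sqrt ((poly h x)\<^sup>2 + 4))) ^ (n - 1) *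
           poly (beta_poly (n - 1))
             (- \<i> * of_real (poly h x) / of_real (sqrt ((poly h x)\<^sup>2 + 4)))
         = of_real (1 / 2 ^ (n - 1) *
             (\<Sum>k=0..(n - 1) div 2.
                real (n choose (2 * k + 1)) * (poly h x) ^ (n - 1 - 2 * k) *
                ((poly h x)\<^sup>2 + 4) ^ k))"
proof -
  define H where "H = poly h x"
  define s where "s = sqrt (H\<^sup>2 + 4)"
  have "H\<^sup>2 + 4 > 0" by (rule add_nonneg_pos) auto
  then have s0: "complex_of_real s \<noteq> 0" by (simp add: s_def)
  have s2: "(complex_of_real s)\<^sup>2 = of_real (H\<^sup>2 + 4)"
    by (simp add: s_def flip: of_real_power)
  \<comment> \<open>With \<open>m = n - 1\<close>, the upper binomial index \<open>Suc m\<close>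
    becomes \<open>n\<close>, matching the sum obtained from Binet's formula.\<close>
  have "Suc (n - 1) = n" using assms by simp
  then have "(\<i> / 2) ^ (n - 1) * of_real s ^ (n - 1) *
      poly (beta_poly (n - 1)) (- \<i> * of_real H / of_real s) =
      of_real (1 / 2 ^ (n - 1) *
        (\<Sum>k=0..(n - 1) div 2.
           real (n choose (2 * k + 1)) * H ^ (n - 1 - 2 * k) * (H\<^sup>2 + 4) ^ k))"
    using scaled_beta_poly_eq_sum[OF s0, of "n - 1" "of_real H"]
    unfolding s2 by simp
  then show ?thesis
    using poly_h_fibonacci_eq_sum[OF assms, of h x] unfolding s_def H_def by metis
qed

end
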